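(* Let $\|\cdot\|$ be a smooth and strictly convex norm on $\mathbb{R}^n$, let $f:\mathbb{R}^n\to\mathbb{R}$ be a convex function, let $x\in\mathbb{R}^n$ and $c=f(x)$. Assume that $c$ is not a global minimum of $f$, and let $v\in\mathbb{R}^n$ be a norm sub-gradient of $f$ at $x$. Then the hyperplane $\mathbf{h}$ which is Birkhoff right-orthogonal to $v$ supports $\{f\le c\}$ at $x$. Moreover, $$\sup\{f'_-(x,v+z):z\in\mathbf{h}\}\le\|v\|^2\le\inf\{f'_+(x,v+z):z\in\mathbf{h}\}.$$
   Context: A norm is smooth if its unit ball $B=\{x:\|x\|\le 1\}$ has a unique supporting hyperplane at each boundary point, and strictly convex if $\partial B$ contains no (non-degenerate) line segment. A hyperplane $\mathbf{h}$ (regarded as a linear hyperplane through the origin) supports a closed convex set $C$ at $x\in\partial C$ if $C$ is contained in one of the closed half-spaces determined by the translate $x+\mathbf{h}$. The sub-level set is $\{f\le c\}=\{z\in\mathbb{R}^n:f(z)\le c\}$. Birkhoff orthogonality: $x\dashv_B y$ means $\|x+ty\|\ge\|x\|$ for all $t\in\mathbb{R}$; $x\dashv_B\mathbf{h}$ means $x\dashv_B z$ for all $z\in\mathbf{h}$, and then $\mathbf{h}$ is called Birkhoff right-orthogonal to $x$. Each non-zero vector has a unique Birkhoff right-orthogonal hyperplane because the norm is smooth. (Since $c$ is not a global minimum, a norm sub-gradient $v$ at $x$ is non-zero.) Legendre transform: $\mathcal{L}:\mathbb{R}^n\to(\mathbb{R}^n)^*$ sends $x\ne 0$ to the unique linear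 functional $\mathcal{L}(x)$ whose kernel is the hyperplane Birkhoff right-orthogonal to $x$ and with $\mathcal{L}(x)\cdot x=\|x\|^2$; $\mathcal{L}(0)=0$. A vector $v$ is a norm sub-gradient of $f$ at $x$ if $f(y)-f(x)\ge\mathcal{L}(v)\cdot(y-x)$ for all $y\in\mathbb{R}^n$. One-sided derivatives: $f'_+(x,u)=\lim_{t\to0^+}\frac{f(x+tu)-f(x)}{t}$ and $f'_-(x,u)=\lim_{t\to0^-}\frac{f(x+tu)-f(x)}{t}=-f'_+(x,-u)$. *)

theory Defs
  imports "HOL-Analysis.Analysis" "HOL-Library.Extended_Real"
begin

text \<open>
  The norm is an arbitrary function \<open>N\<close> on \<open>real ^ 'n\<close>, not the Euclidean norm of the
  type class. The Euclidean structure is used only to write linear hyperplanes as kernels of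
  \<open>\<lambda>z. a \<bullet> z\<close> and for the (norm-independent) topology.
\<close>

definition is_norm :: "(real ^ 'n \<Rightarrow> real) \<Rightarrow> bool" where
  "is_norm N \<longleftrightarrow>
     (\<forall>x. 0 \<le> N x) \<and> (\<forall>x. N x = 0 \<longleftrightarrow> x = 0) \<and>
     (\<forall>a x. N (a *\<^sub>R x) = \<bar>a\<bar> * N x) \<and> (\<forall>x y. N (x + y) \<le> N x + N y)"

definition unit_ball :: "(real ^ 'n \<Rightarrow> real) \<Rightarrow> (real ^ 'n) set" where
  "unit_ball N = {x. N x \<le> 1}"

definition linear_hyperplane :: "(real ^ 'n) set \<Rightarrow> bool" where
  "linear_hyperplane H \<longleftrightarrow> (\<exists>a. a \<noteq> 0 \<and> H = {z. a \<bullet> z = 0})"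

text \<open>
  Replacing \<open>a\<close> by \<open>- a\<close> exchanges the two closed half-spaces bounded by the translate
  \<open>x + H\<close>, so a single inequality covers both.
\<close>

definition supports :: "(real ^ 'n) set \<Rightarrow> (real ^ 'n) set \<Rightarrow> real ^ 'n \<Rightarrow> bool" where
  "supports H C x \<longleftrightarrow>
     closed C \<and> convex C \<and> x \<in> frontier C \<and>
     (\<exists>a. a \<noteq> 0 \<and> H = {z. a \<bullet> z = 0} \<and> C \<subseteq> {y. a \<bullet> y \<le> a \<bullet> x})"

definition smooth_norm :: "(real ^ 'n \<Rightarrow> real) \<Rightarrow> bool" where
  "smooth_norm N \<longleftrightarrow> (\<forall>x \<in> frontier (unit_ball N). \<exists>!H. supports H (unit_ball N) x)"

definition strictly_convex_norm :: "(real ^ 'n \<Rightarrow> real) \<Rightarrow> bool" where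
  "strictly_convex_norm N \<longleftrightarrow>
     (\<forall>a b. a \<noteq> b \<longrightarrow> \<not> closed_segment a b \<subseteq> frontier (unit_ball N))"

definition birkhoff_orthogonal :: "(real ^ 'n \<Rightarrow> real) \<Rightarrow> real ^ 'n \<Rightarrow> real ^ 'n \<Rightarrow> bool" where
  "birkhoff_orthogonal N x y \<longleftrightarrow> (\<forall>t. N x \<le> N (x + t *\<^sub>R y))"

text \<open>For a smooth norm and \<open>x \<noteq> 0\<close> the hyperplane described here exists and is unique.\<close>

definition right_orthogonal_hyperplane ::
    "(real ^ 'n \<Rightarrow> real) \<Rightarrow> real ^ 'n \<Rightarrow> (real ^ 'n) set" where
  "right_orthogonal_hyperplane N x =
     (THE H. linear_hyperplane H \<and> (\<forall>z \<in> H. birkhoff_orthogonal N x z))"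

definition legendre :: "(real ^ 'n \<Rightarrow> real) \<Rightarrow> real ^ 'n \<Rightarrow> (real ^ 'n \<Rightarrow> real)" where
  "legendre N x =
     (if x = 0 then (\<lambda>y. 0)
      else (THE l. linear l \<and> {z. l z = 0} = right_orthogonal_hyperplane N x \<and> l x = (N x)\<^sup>2))"

definition norm_subgradient ::
    "(real ^ 'n \<Rightarrow> real) \<Rightarrow> (real ^ 'n \<Rightarrow> real) \<Rightarrow> real ^ 'n \<Rightarrow> real ^ 'n \<Rightarrow> bool" where
  "norm_subgradient N f x v \<longleftrightarrow> (\<forall>y. f y - f x \<ge> legendre N v (y - x))"

text \<open>For convex \<open>f\<close> on the whole space both limits exist.\<close>

definition right_deriv :: "(real ^ 'n \<Rightarrow> real) \<Rightarrow> real ^ 'n \<Rightarrow> real ^ 'n \<Rightarrow> real" where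
  "right_deriv f x u = Lim (at_right 0) (\<lambda>t. (f (x + t *\<^sub>R u) - f x) / t)"

definition left_deriv :: "(real ^ 'n \<Rightarrow> real) \<Rightarrow> real ^ 'n \<Rightarrow> real ^ 'n \<Rightarrow> real" where
  "left_deriv f x u = Lim (at_left 0) (\<lambda>t. (f (x + t *\<^sub>R u) - f x) / t)"

end

theory Submission
  imports Defs
begin

text \<open>
  A hyperplane is Birkhoff right-orthogonal to \<open>v \<noteq> 0\<close> iff it supports the unit ball at the
  normalisation of \<open>v\<close>, so smoothness makes it unique and the Legendre transform of \<open>v\<close> is a
  functional \<open>y \<mapsto> g \<bullet> y\<close> with kernel \<open>h\<close> and \<open>g \<bullet> v = \<parallel>v\<parallel>\<^sup>2\<close>. Thus \<open>g\<close> is an ordinary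
  sub-gradient of \<open>f\<close> at \<open>x\<close>. It is nonpositive on \<open>{f \<le> c} - x\<close>, which is the support claim, and
  it separates the one-sided derivatives in every direction \<open>u\<close>; for \<open>u = v + z\<close> with \<open>z \<in> h\<close>
  one has \<open>g \<bullet> u = \<parallel>v\<parallel>\<^sup>2\<close>.
\<close>

text \<open>The frontier condition is automatic: since \<open>a\<close> is nonzero, interior points
  of \<open>C\<close> satisfy the strict inequality, which \<open>x\<close> does not.\<close>

lemma supportsI:
  fixes C :: "(real ^ 'n) set"
  assumes "closed C" "convex C" "x \<in> C" "a \<noteq> 0" "C \<subseteq> {y. a \<bullet> y \<le> a \<bullet> x}"
  shows "supports {z. a \<bullet> z = 0} C x"
proof -
  have "interior C \<subseteq> {y. a \<bullet> y < a \<bullet> x}"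
    using interior_mono[OF assms(5)] interior_halfspace_le[OF assms(4), of "a \<bullet> x"] by auto
  hence "x \<in> frontier C"
    using assms(1,3) by (auto simp: frontier_def)
  thus ?thesis unfolding supports_def using assms by blast
qed

lemma convex_sublevel_set:
  assumes "convex_on S f"
  shows "convex {x \<in> S. f x \<le> c}"
proof (rule convexI)
  fix x y and u v :: real
  assume *: "x \<in> {x \<in> S. f x \<le> c}" "y \<in> {x \<in> S. f x \<le> c}" "0 \<le> u" "0 \<le> v" "u + v = 1"
  have "f (u *\<^sub>R x + v *\<^sub>R y) \<le> u * f x + v * f y"
    using assms * by (auto simp: convex_on_def)
  also have "\<dots> \<le> c" using convex_bound_le[of "f x" c "f y" u v] * by simp
  finally show "u *\<^sub>R x + v *\<^sub>R y \<in> {x \<in> S. f x \<le> c}"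
    using * convexD[OF convex_on_imp_convex[OF assms]] by blast
qed

context
  fixes N :: "real ^ 'n \<Rightarrow> real"
  assumes is_norm: "is_norm N"
begin

lemma
  shows norm_nonneg: "0 \<le> N x"
    and norm_eq_0: "N x = 0 \<longleftrightarrow> x = 0"
    and norm_scale: "N (a *\<^sub>R x) = \<bar>a\<bar> * N x"
    and norm_add: "N (x + y) \<le> N x + N y"
  using is_norm by (auto simp: is_norm_def)

lemma norm_pos: "x \<noteq> 0 \<Longrightarrow> 0 < N x"
  using norm_nonneg[of x] norm_eq_0[of x] by linarith

text \<open>Convexity yields continuity of \<open>N\<close> in the Euclidean topology, hence
  closedness of the unit ball, as well as convexity of the ball.\<close>

lemma convex_on_norm: "convex_on UNIV N"
proof (rule convex_onI)
  fix t x y assume "0 < t" "t < (1::real)"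
  thus "N ((1 - t) *\<^sub>R x + t *\<^sub>R y) \<le> (1 - t) * N x + t * N y"
    using norm_add[of "(1 - t) *\<^sub>R x" "t *\<^sub>R y"] by (simp add: norm_scale)
qed simp

lemma closed_unit_ball: "closed (unit_ball N)"
  unfolding unit_ball_def
  using convex_on_continuous[OF open_UNIV convex_on_norm]
  by (intro closed_Collect_le) simp_all

lemma convex_unit_ball: "convex (unit_ball N)"
  unfolding unit_ball_def using convex_sublevel_set[OF convex_on_norm] by simp

lemma in_frontier_unit_ball:
  assumes "N w = 1"
  shows "w \<in> frontier (unit_ball N)"
proof -
  have "w \<notin> interior (unit_ball N)"
  proof
    assume "w \<in> interior (unit_ball N)"
    then obtain e where e: "e > 0" "cball w e \<subseteq> unit_ball N"
      unfolding mem_interior_cball by blast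
    have w: "w \<noteq> 0" using assms norm_eq_0[of 0] by auto
    \<comment> \<open>The radial point \<open>s *\<^sub>R w\<close> lies at Euclidean distance
      exactly \<open>e\<close> from \<open>w\<close>, yet \<open>N\<close> takes the value
      \<open>s > 1\<close> there.\<close>
    define s where "s = 1 + e / norm w"
    have s: "s > 1" using e w by (simp add: s_def)
    have "s *\<^sub>R w \<in> cball w e"
      using w e by (simp add: s_def dist_norm algebra_simps)
    hence "N (s *\<^sub>R w) \<le> 1" using e by (auto simp: unit_ball_def)
    thus False using s assms by (simp add: norm_scale)
  qed
  thus ?thesis using assms closed_unit_ball by (auto simp: frontier_def unit_ball_def)
qed

text \<open>With \<open>w\<close> the normalisation of \<open>v\<close>, both sides say that the
  translate \<open>w + H\<close> misses the open ball where \<open>N < 1\<close>. This turns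
  smoothness, a statement about the unit ball, into one about Birkhoff orthogonality.\<close>

lemma right_orthogonal_iff_supports:
  assumes v: "v \<noteq> 0"
  shows "linear_hyperplane H \<and> (\<forall>z\<in>H. birkhoff_orthogonal N v z) \<longleftrightarrow>
    supports H (unit_ball N) ((1 / N v) *\<^sub>R v)"
proof -
  define w where "w = (1 / N v) *\<^sub>R v"
  have Nv: "N v > 0" using norm_pos[OF v] .
  have vw: "v = N v *\<^sub>R w" using Nv by (simp add: w_def)
  have Nw: "N w = 1" using Nv by (simp add: w_def norm_scale)
  show ?thesis unfolding w_def[symmetric]
  proof
    assume *: "linear_hyperplane H \<and> (\<forall>z\<in>H. birkhoff_orthogonal N v z)"
    then obtain a0 where a0: "a0 \<noteq> 0" "H = {z. a0 \<bullet> z = 0}"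
      by (auto simp: linear_hyperplane_def)
    have orth: "1 \<le> N (w + z)" if "z \<in> H" for z
    proof -
      have "N v \<le> N (v + N v *\<^sub>R z)" using * that by (auto simp: birkhoff_orthogonal_def)
      also have "v + N v *\<^sub>R z = N v *\<^sub>R (w + z)" by (subst vw) (simp add: scaleR_add_right)
      also have "N \<dots> = N v * N (w + z)" using Nv by (simp add: norm_scale)
      finally show ?thesis using Nv by simp
    qed
    \<comment> \<open>Otherwise \<open>- w\<close> would lie in \<open>H\<close>, and
      \<open>orth\<close> would give \<open>1 \<le> N 0\<close>. The sign of the normal can then be
      chosen without changing its kernel.\<close>
    have "a0 \<bullet> w \<noteq> 0"
      using orth[of "- w"] a0 norm_eq_0[of 0] by auto
    then obtain a where a: "a \<noteq> 0" "H = {z. a \<bullet> z = 0}" "a \<bullet> w > 0"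
    proof (cases "a0 \<bullet> w > 0")
      case True
      thus ?thesis using that[of a0] a0 by blast
    next
      case False
      thus ?thesis using that[of "- a0"] a0 \<open>a0 \<bullet> w \<noteq> 0\<close> by simp
    qed
    have "a \<bullet> y \<le> a \<bullet> w" if y: "N y \<le> 1" for y
    proof (rule ccontr)
      assume less: "\<not> a \<bullet> y \<le> a \<bullet> w"
      \<comment> \<open>Shrinking \<open>y\<close> by the factor \<open>s > 1\<close> puts it on
        \<open>w + H\<close> while making its norm less than 1, against \<open>orth\<close>.\<close>
      define s where "s = (a \<bullet> y) / (a \<bullet> w)"
      have s: "s > 1" using less a by (simp add: s_def)
      have "a \<bullet> ((1 / s) *\<^sub>R y - w) = 0"
        using s a by (simp add: s_def inner_diff_right)
      hence "1 \<le> N (w + ((1 / s) *\<^sub>R y - w))" using orth a by blast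
      also have "\<dots> = N y / s" using s by (simp add: norm_scale)
      also have "\<dots> < 1" using s y by simp
      finally show False by simp
    qed
    hence "unit_ball N \<subseteq> {y. a \<bullet> y \<le> a \<bullet> w}" by (auto simp: unit_ball_def)
    thus "supports H (unit_ball N) w"
      using supportsI[OF closed_unit_ball convex_unit_ball _ a(1)] a(2) Nw
      by (simp add: unit_ball_def)
  next
    assume "supports H (unit_ball N) w"
    then obtain a where a: "a \<noteq> 0" "H = {z. a \<bullet> z = 0}"
      and le: "\<And>y. N y \<le> 1 \<Longrightarrow> a \<bullet> y \<le> a \<bullet> w"
      unfolding supports_def unit_ball_def by blast
    have Na: "N a > 0" using norm_pos[OF a(1)] .
    \<comment> \<open>Testing the support inequality on \<open>a\<close> itself, scaled into the
      ball, shows that \<open>a \<bullet> w\<close> is positive and may be cancelled below.\<close>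
    have "a \<bullet> ((1 / N a) *\<^sub>R a) \<le> a \<bullet> w"
      using Na by (intro le) (simp add: norm_scale)
    moreover have "a \<bullet> ((1 / N a) *\<^sub>R a) > 0" using Na a by simp
    ultimately have aw: "a \<bullet> w > 0" by linarith
    have "birkhoff_orthogonal N v z" if z: "z \<in> H" for z
      unfolding birkhoff_orthogonal_def
    proof
      fix t
      define y where "y = v + t *\<^sub>R z"
      have ay: "a \<bullet> y = N v * (a \<bullet> w)"
        using z a by (simp add: y_def inner_add_right, subst vw, simp)
      hence "a \<bullet> y > 0" using Nv aw by simp
      hence "y \<noteq> 0" by auto
      hence Ny: "N y > 0" using norm_pos by blast
      \<comment> \<open>Moving along \<open>H\<close> leaves the value of \<open>a\<close>
        unchanged, so the support inequality at the normalised \<open>y\<close> compares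
        \<open>N v\<close> with \<open>N y\<close>.\<close>
      have "a \<bullet> ((1 / N y) *\<^sub>R y) \<le> a \<bullet> w"
        using Ny by (intro le) (simp add: norm_scale)
      hence "N v * (a \<bullet> w) \<le> N y * (a \<bullet> w)" using Ny ay by (simp add: field_simps)
      thus "N v \<le> N y" using aw by simp
    qed
    thus "linear_hyperplane H \<and> (\<forall>z\<in>H. birkhoff_orthogonal N v z)"
      using a by (auto simp: linear_hyperplane_def)
  qed
qed

lemma ex1_right_orthogonal:
  assumes "smooth_norm N" "v \<noteq> 0"
  shows "\<exists>!H. linear_hyperplane H \<and> (\<forall>z\<in>H. birkhoff_orthogonal N v z)"
proof -
  have "N ((1 / N v) *\<^sub>R v) = 1"
    using norm_pos[OF assms(2)] by (simp add: norm_scale)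
  thus ?thesis
    unfolding right_orthogonal_iff_supports[OF assms(2)]
    using assms(1) in_frontier_unit_ball by (auto simp: smooth_norm_def)
qed

text \<open>Since \<open>v\<close> lies outside its right-orthogonal hyperplane, the two span the
  space. A functional is thus fixed by this kernel and its value at \<open>v\<close>, and rescaling
  any normal of the hyperplane produces it.\<close>

lemma legendre_eq_inner:
  assumes "smooth_norm N" and v: "v \<noteq> 0"
  obtains g where "g \<noteq> 0" "legendre N v = (\<lambda>y. g \<bullet> y)" "g \<bullet> v = (N v)\<^sup>2"
    "right_orthogonal_hyperplane N v = {z. g \<bullet> z = 0}"
proof -
  define H where "H = right_orthogonal_hyperplane N v"
  have H: "linear_hyperplane H" "\<forall>z\<in>H. birkhoff_orthogonal N v z"
    using theI'[OF ex1_right_orthogonal[OF assms]]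
    by (simp_all add: H_def right_orthogonal_hyperplane_def)
  obtain a where a: "a \<noteq> 0" "H = {z. a \<bullet> z = 0}"
    using H(1) by (auto simp: linear_hyperplane_def)
  have Nv: "N v > 0" using norm_pos[OF v] .
  have av: "a \<bullet> v \<noteq> 0"
  proof
    assume "a \<bullet> v = 0"
    hence "N v \<le> N (v + (-1) *\<^sub>R v)" using H(2) a unfolding birkhoff_orthogonal_def by blast
    thus False using Nv norm_eq_0[of 0] by simp
  qed
  define g where "g = ((N v)\<^sup>2 / (a \<bullet> v)) *\<^sub>R a"
  have g: "g \<noteq> 0" "g \<bullet> v = (N v)\<^sup>2" "H = {z. g \<bullet> z = 0}"
    using a av Nv by (auto simp: g_def)
  have "(THE l. linear l \<and> {z. l z = 0} = H \<and> l v = (N v)\<^sup>2) = (\<lambda>y. g \<bullet> y)"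
  proof (rule the_equality)
    show "linear (\<lambda>y. g \<bullet> y) \<and> {z. g \<bullet> z = 0} = H \<and> g \<bullet> v = (N v)\<^sup>2"
      using g by (simp add: bounded_linear_inner_right bounded_linear.linear)
  next
    fix l assume l: "linear l \<and> {z. l z = 0} = H \<and> l v = (N v)\<^sup>2"
    show "l = (\<lambda>y. g \<bullet> y)"
    proof
      fix y
      \<comment> \<open>This is the projection of \<open>y\<close> onto \<open>H\<close> along
        \<open>v\<close>.\<close>
      define z where "z = y - (g \<bullet> y / (N v)\<^sup>2) *\<^sub>R v"
      have "g \<bullet> z = 0" using g Nv by (simp add: z_def inner_diff_right)
      hence "l z = 0" using l g by blast
      moreover have "l z = l y - (g \<bullet> y / (N v)\<^sup>2) * l v"
        using l by (simp add: z_def linear_diff linear_scale)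
      ultimately show "l y = g \<bullet> y" using l Nv by simp
    qed
  qed
  hence "legendre N v = (\<lambda>y. g \<bullet> y)" using v by (simp add: legendre_def H_def)
  thus thesis using that g by (simp add: H_def)
qed

end

text \<open>For \<open>t > 0\<close> the quotient is nondecreasing in \<open>t\<close> by convexity
  and bounded below by \<open>g \<bullet> u\<close>, so it converges to its infimum, which inherits
  the bound.\<close>

lemma convex_on_difference_quotient_tendsto:
  fixes f :: "real ^ 'n \<Rightarrow> real"
  assumes "convex_on UNIV f" and sub: "\<And>y. g \<bullet> (y - x) \<le> f y - f x"
  obtains L where "((\<lambda>t. (f (x + t *\<^sub>R u) - f x) / t) \<longlongrightarrow> L) (at_right 0)" "g \<bullet> u \<le> L"
proof -
  define q where "q = (\<lambda>t. (f (x + t *\<^sub>R u) - f x) / t)"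
  have lower: "g \<bullet> u \<le> q t" if "t > 0" for t
    using that sub[of "x + t *\<^sub>R u"] by (simp add: q_def field_simps)
  have mono: "q s \<le> q t" if st: "0 < s" "s \<le> t" for s t
  proof -
    \<comment> \<open>The nearer point is a convex combination of \<open>x\<close> and the farther
      one, with weight \<open>s / t\<close>.\<close>
    have "x + s *\<^sub>R u = (1 - s / t) *\<^sub>R x + (s / t) *\<^sub>R (x + t *\<^sub>R u)"
      using st by (simp add: algebra_simps)
    hence "f (x + s *\<^sub>R u) \<le> (1 - s / t) * f x + (s / t) * f (x + t *\<^sub>R u)"
      using convex_onD[OF assms(1), of "s / t" x "x + t *\<^sub>R u"] st by simp
    thus ?thesis using st by (simp add: q_def field_simps)
  qed
  have "(q \<longlongrightarrow> Inf (q ` ({0<..} \<inter> UNIV))) (at 0 within ({0<..} \<inter> UNIV))"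
    by (rule Lim_right_bound[where K = "g \<bullet> u"]) (use lower mono in auto)
  hence lim: "(q \<longlongrightarrow> Inf (q ` {0<..})) (at_right 0)" by simp
  have "g \<bullet> u \<le> Inf (q ` {0<..})"
    by (rule cInf_greatest) (use lower in auto)
  thus thesis using that lim by (simp add: q_def)
qed

lemma subgradient_le_right_deriv:
  fixes f :: "real ^ 'n \<Rightarrow> real"
  assumes "convex_on UNIV f" "\<And>y. g \<bullet> (y - x) \<le> f y - f x"
  shows "g \<bullet> u \<le> right_deriv f x u"
proof -
  obtain L where L: "((\<lambda>t. (f (x + t *\<^sub>R u) - f x) / t) \<longlongrightarrow> L) (at_right 0)" "g \<bullet> u \<le> L"
    using convex_on_difference_quotient_tendsto[OF assms] .
  have "right_deriv f x u = L"
    unfolding right_deriv_def by (rule tendsto_Lim[OF _ L(1)]) simp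
  thus ?thesis using L(2) by simp
qed

text \<open>The substitution of \<open>- t\<close> for \<open>t\<close> reduces this to the
  right-hand limit in direction \<open>- u\<close>.\<close>

lemma left_deriv_le_subgradient:
  fixes f :: "real ^ 'n \<Rightarrow> real"
  assumes "convex_on UNIV f" "\<And>y. g \<bullet> (y - x) \<le> f y - f x"
  shows "left_deriv f x u \<le> g \<bullet> u"
proof -
  obtain L where L: "((\<lambda>t. (f (x + t *\<^sub>R (- u)) - f x) / t) \<longlongrightarrow> L) (at_right 0)"
      "g \<bullet> (- u) \<le> L"
    using convex_on_difference_quotient_tendsto[OF assms, of "- u"] .
  have "((\<lambda>t. (f (x + t *\<^sub>R u) - f x) / t) \<longlongrightarrow> - L) (at_left 0)"
    using tendsto_minus[OF L(1)] by (simp add: filterlim_at_left_to_right)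
  hence "left_deriv f x u = - L"
    unfolding left_deriv_def by (intro tendsto_Lim) simp_all
  thus ?thesis using L(2) by simp
qed

theorem theorem4p4:
  fixes N :: "real ^ 'n \<Rightarrow> real" and f :: "real ^ 'n \<Rightarrow> real"
    and x v :: "real ^ 'n" and c :: real and h :: "(real ^ 'n) set"
  assumes "is_norm N" and "smooth_norm N" and "strictly_convex_norm N"
    and "convex_on UNIV f"
    and "c = f x"
    and "\<not> (\<forall>y. c \<le> f y)"
    and "norm_subgradient N f x v"
    and "h = right_orthogonal_hyperplane N v"
  shows "supports h {z. f z \<le> c} x \<and>
    (SUP z\<in>h. ereal (left_deriv f x (v + z))) \<le> ereal ((N v)\<^sup>2) \<and>
    ereal ((N v)\<^sup>2) \<le> (INF z\<in>h. ereal (right_deriv f x (v + z)))"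
proof -
  \<comment> \<open>The Legendre transform of 0 is the zero functional, so \<open>v = 0\<close>
    would make \<open>f x\<close> a global minimum.\<close>
  have "v \<noteq> 0"
    using assms(5-7) by (auto simp: norm_subgradient_def legendre_def)
  then obtain g where g: "g \<noteq> 0" "legendre N v = (\<lambda>y. g \<bullet> y)" "g \<bullet> v = (N v)\<^sup>2"
      and h: "h = {z. g \<bullet> z = 0}"
    using legendre_eq_inner[OF assms(1,2)] assms(8) by metis
  have sub: "g \<bullet> (y - x) \<le> f y - f x" for y
    using assms(7) g by (simp add: norm_subgradient_def)
  have "closed {z. f z \<le> c}"
    using convex_on_continuous[OF open_UNIV assms(4)]
    by (intro closed_Collect_le) simp_all
  moreover have "convex {z. f z \<le> c}"
    using convex_sublevel_set[OF assms(4)] by simp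
  moreover have "{z. f z \<le> c} \<subseteq> {y. g \<bullet> y \<le> g \<bullet> x}"
  proof safe
    fix y assume "f y \<le> c"
    thus "g \<bullet> y \<le> g \<bullet> x" using sub[of y] assms(5) by (simp add: inner_diff_right)
  qed
  ultimately have "supports h {z. f z \<le> c} x"
    unfolding h using supportsI[of "{z. f z \<le> c}" x g] g(1) assms(5) by simp
  moreover have gz: "g \<bullet> (v + z) = (N v)\<^sup>2" if "z \<in> h" for z
    using that g h by (simp add: inner_add_right)
  moreover have "left_deriv f x (v + z) \<le> (N v)\<^sup>2" if "z \<in> h" for z
    using left_deriv_le_subgradient[OF assms(4) sub, of "v + z"] gz[OF that] by simp
  moreover have "(N v)\<^sup>2 \<le> right_deriv f x (v + z)" if "z \<in> h" for z
    using subgradient_le_right_deriv[OF assms(4) sub, of "v + z"] gz[OF that] by simp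
  ultimately show ?thesis by (auto intro!: SUP_least INF_greatest)
qed

end
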